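(* Let $V_1,V_2,V_3,V_4$ be $3$-dimensional complex vector spaces and let $G=\mathfrak{S}_4\ltimes \mathrm{GL}(3)^{\times 4}$. Suppose $Q\in V_1\otimes V_2\otimes V_3\otimes V_4$ is a quadrifocal tensor. Then the $600$ cubic polynomials forming a basis of the $G$-module $S_{3}S_{3}S_{1,1,1}S_{1,1,1}\subset S^3(V_1^*\otimes V_2^*\otimes V_3^*\otimes V_4^* )$ vanish on $Q$.
   Context: The ground field is $\mathbb{C}$. Given four $3\times 4$ matrices $A_1,A_2,A_3,A_4$ of full rank (camera matrices), form the $4\times 12$ block matrix $A=(A_1^{\top}\mid A_2^{\top}\mid A_3^{\top}\mid A_4^{\top})$. For $1\le i,j,k,l\le 3$ let $Q_{i,j,k,l}(A)$ be the $4\times 4$ minor of $A$ formed by column $i$ of block $1$, column $j$ of block $2$, column $k$ of block $3$ and column $l$ of block $4$ (in this order). Fixing bases $V_i\cong\mathbb{C}^3$, a quadrifocal tensor is a tensor of the form $Q(A)=(Q_{i,j,k,l}(A))\in V_1\otimes V_2\otimes V_3\otimes V_4$. $S^3(V_1^*\otimes V_2^*\otimes V_3^*\otimes V_4^* )$ is the space of homogeneous cubic polynomials on $V_1\otimes V_2\otimes V_3\otimes V_4$. $S_\pi$ denotes the Schur functor of the partition $\pi$, so $S_3V=S^3V$ is the symmetric cube and $S_{1,1,1}V=\bigwedge^3V$. The notation $S_{3}S_{3}S_{1,1,1}S_{1,1,1}$ means the direct sum of $S_3V_1^*\otimes S_3V_2^*\otimes S_{1,1,1}V_3^*\otimes S_{1,1,1}V_4^*$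 and all its distinct copies under permutation of the four indices, i.e. the direct sum, over the six ways of splitting $\{1,2,3,4\}=\{i,j\}\sqcup\{k,l\}$ into an ordered pair of $2$-element subsets, of the $100$-dimensional $\mathrm{GL}(3)^{\times4}$-modules $\bigwedge^3V_i^*\otimes\bigwedge^3V_j^*\otimes S^3V_k^*\otimes S^3V_l^*$, each of which occurs with multiplicity one in $S^3(V_1^*\otimes V_2^*\otimes V_3^*\otimes V_4^* )$. Explicitly, the summand for $\{i,j\}=\{1,2\}$, $\{k,l\}=\{3,4\}$ is spanned by the coefficients, viewed as cubic polynomials in the entries $Q_{p,q,r,s}$ of $Q$, of the bihomogeneous form of bidegree $(3,3)$ in the variables $a=(a_1,a_2,a_3)$ and $x=(x_1,x_2,x_3)$ given by $$\det\Bigl(\sum_{r,s=1}^{3} a_r x_s\, Q_{p,q,r,s}\Bigr)_{1\le p,q\le 3},$$ and the other five summands are obtained in the same way by permuting the roles of the four tensor factors. *)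

theory Defs
  imports "HOL-Analysis.Analysis" "HOL-Library.Poly_Mapping"
begin

text \<open>
  Coordinates with respect to fixed bases: an element of \<open>V\<^sub>1 \<otimes> V\<^sub>2 \<otimes> V\<^sub>3 \<otimes> V\<^sub>4\<close> is its family of
  entries, and a multi-index \<open>I :: 4 \<Rightarrow> 3\<close> has \<open>I c\<close> as its index in the tensor factor \<open>c\<close>.
  In the numeral types \<open>3\<close> and \<open>4\<close> the last element is \<open>3 = 0\<close>, respectively \<open>4 = 0\<close>.
\<close>

type_synonym multi_index = "4 \<Rightarrow> 3"
type_synonym tensor = "multi_index \<Rightarrow> complex"

definition block_matrix :: "(4 \<Rightarrow> complex^4^3) \<Rightarrow> complex^(4 \<times> 3)^4" where
  "block_matrix A = (\<chi> m cn. transpose (A (fst cn)) $ m $ snd cn)"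

definition quadrifocal_of :: "(4 \<Rightarrow> complex^4^3) \<Rightarrow> tensor" where
  "quadrifocal_of A = (\<lambda>I. det (\<chi> m c. block_matrix A $ m $ (c, I c)))"

definition quadrifocal :: "tensor \<Rightarrow> bool" where
  "quadrifocal Q \<longleftrightarrow> (\<exists>A. (\<forall>c. rank (A c) = 3) \<and> Q = quadrifocal_of A)"

text \<open>
  \<open>('v, 'a) mpoly\<close> is the polynomial ring over \<open>'a\<close> in the variables \<open>'v\<close>: monomials are
  exponent vectors, and the ring structure is the convolution product of \<^theory>\<open>HOL-Library.Poly_Mapping\<close>.
\<close>

type_synonym ('v, 'a) mpoly = "('v \<Rightarrow>\<^sub>0 nat) \<Rightarrow>\<^sub>0 'a"

definition mvar :: "'v \<Rightarrow> ('v, 'a::comm_ring_1) mpoly" where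
  "mvar v = Poly_Mapping.single (Poly_Mapping.single v 1) 1"

definition mconst :: "'a::comm_ring_1 \<Rightarrow> ('v, 'a) mpoly" where
  "mconst c = Poly_Mapping.single 0 c"

definition meval :: "('v::finite, 'a::comm_ring_1) mpoly \<Rightarrow> ('v \<Rightarrow> 'a) \<Rightarrow> 'a" where
  "meval f x = (\<Sum>m\<in>Poly_Mapping.keys f. Poly_Mapping.lookup f m * (\<Prod>v\<in>UNIV. x v ^ Poly_Mapping.lookup m v))"

type_synonym tensor_poly = "(multi_index, complex) mpoly"

global_interpretation tpoly: vector_space "\<lambda>c (f :: tensor_poly). mconst c * f"
  by unfold_locales
    (simp_all add: mconst_def algebra_simps single_add mult_single flip: mult.assoc)

definition cubic_forms :: "tensor_poly set" where
  "cubic_forms = {f. \<forall>m\<in>Poly_Mapping.keys f. (\<Sum>I\<in>UNIV. Poly_Mapping.lookup m I) = 3}"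

text \<open>
  For distinct \<open>i, j, k, l\<close>: the determinant over the indices of the factors \<open>i\<close> and \<open>j\<close>, after
  contracting the factor \<open>k\<close> with \<open>a\<close> and the factor \<open>l\<close> with \<open>x\<close>. It is a polynomial in
  \<open>a\<^sub>r = mvar (Inl r)\<close> and \<open>x\<^sub>s = mvar (Inr s)\<close> whose coefficients are polynomials in the entries
  of a generic tensor.
\<close>

definition det_form :: "4 \<Rightarrow> 4 \<Rightarrow> 4 \<Rightarrow> 4 \<Rightarrow> (3 + 3, tensor_poly) mpoly" where
  "det_form i j k l =
    det (\<chi> p q. \<Sum>r\<in>UNIV. \<Sum>s\<in>UNIV.
      mvar (Inl r) * mvar (Inr s) * mconst (mvar ((\<lambda>_. 0)(i := p, j := q, k := r, l := s))))"

text \<open>\<open>\<And>\<^sup>3V\<^sub>i\<^sup>* \<otimes> \<And>\<^sup>3V\<^sub>j\<^sup>* \<otimes> S\<^sup>3V\<^sub>k\<^sup>* \<otimes> S\<^sup>3V\<^sub>l\<^sup>*\<close> as a space of cubic polynomials.\<close>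

definition summand :: "4 \<Rightarrow> 4 \<Rightarrow> 4 \<Rightarrow> 4 \<Rightarrow> tensor_poly set" where
  "summand i j k l = tpoly.span (range (Poly_Mapping.lookup (det_form i j k l)))"

text \<open>
  The sum of the summands over all splittings \<open>{i, j}, {k, l}\<close>. A summand does not change when
  \<open>i, j\<close> or \<open>k, l\<close> are exchanged, so the 24 arrangements yield six subspaces.
\<close>

definition S3_S3_S111_S111 :: "tensor_poly set" where
  "S3_S3_S111_S111 = tpoly.span (\<Union>{summand i j k l | i j k l. distinct [i, j, k, l]})"

text \<open>
  The transformation of the tensor space given by an element of the semidirect product of the
  symmetric group on the four factors and \<open>GL(3)\<^sup>4\<close>: first permute the factors, then act on each.
\<close>

definition tensor_act :: "(4 \<Rightarrow> 4) \<Rightarrow> (4 \<Rightarrow> complex^3^3) \<Rightarrow> tensor \<Rightarrow> tensor" where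
  "tensor_act \<pi> g T = (\<lambda>J. \<Sum>I\<in>UNIV. (\<Prod>c\<in>UNIV. g c $ J c $ I c) * T (I \<circ> \<pi>))"

text \<open>
  The group acts on polynomials by \<open>f \<mapsto> f \<circ> \<gamma>\<^sup>-\<^sup>1\<close>; as \<open>\<gamma>\<close> ranges over the whole group, the inverse
  can be dropped. The polynomial \<open>h\<close> is determined by its values, the ground field being infinite.
\<close>

definition G_submodule :: "tensor_poly set \<Rightarrow> bool" where
  "G_submodule W \<longleftrightarrow> tpoly.subspace W \<and>
    (\<forall>\<pi> g. \<pi> permutes UNIV \<longrightarrow> (\<forall>c. invertible (g c)) \<longrightarrow>
      (\<forall>f\<in>W. \<exists>h\<in>W. \<forall>T. meval h T = meval f (tensor_act \<pi> g T)))"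

end

theory Submission
  imports Defs "HOL-Library.Multiset"
begin

text \<open>
  All determinants are taken in the polynomial ring \<open>\<complex>[a, x]\<close>, so that coefficients can be
  compared directly.

  For a quadrifocal tensor, the contracted matrix has the entries \<open>\<omega>(y\<^sub>p, z\<^sub>q) = det(y\<^sub>p, z\<^sub>q, u, v)\<close>,
  where \<open>y\<^sub>p\<close> and \<open>z\<^sub>q\<close> are the rows of two cameras and \<open>u\<close>, \<open>v\<close> are the contracted rows of the
  other two. Cramer's rule in the form \<open>det(w) y = \<Sum>\<^sub>i det(w with w\<^sub>i replaced by y) w\<^sub>i\<close> holds over any
  commutative ring and yields the three-term Pluecker relation for \<open>\<omega>\<close>, which forces the
  \<open>3 \<times> 3\<close> determinant to vanish.

  A tensor is treated as a multilinear form in four vectors; the group permutes the vectors and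
  multiplies them by matrices. Hence it acts on the form \<open>D(a, x)\<close> of a summand by a permutation of
  the factors, a scalar \<open>det g\<^sub>i det g\<^sub>j\<close> and a linear substitution in \<open>a\<close> and \<open>x\<close>, which yields the
  submodule property.

  For the dimension, take \<open>T = \<Sum>\<^sub>t e\<^bsub>F\<^sub>1(t)\<^esub> \<otimes> e\<^bsub>F\<^sub>2(t)\<^esub> \<otimes> e\<^bsub>F\<^sub>3(t)\<^esub> \<otimes> e\<^bsub>F\<^sub>4(t)\<^esub>\<close>. The form of the
  summand \<open>{i, j}, {k, l}\<close> at \<open>T\<close> is \<open>sgn F\<^sub>i sgn F\<^sub>j \<Prod>\<^sub>t a\<^bsub>F\<^sub>k(t)\<^esub> x\<^bsub>F\<^sub>l(t)\<^esub>\<close>, where \<open>sgn\<close> vanishes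
  outside the permutations. With \<open>F\<^sub>i = F\<^sub>j = id\<close> this is a single monomial. Symmetrising over a
  transposition in \<open>F\<^sub>k\<close> and one in \<open>F\<^sub>l\<close> keeps it and kills the other five forms, in which
  \<open>sgn F\<^sub>k\<close> or \<open>sgn F\<^sub>l\<close> is a factor. This gives functionals dual to the \<open>6 \<cdot> 10 \<cdot> 10\<close> coefficients.
\<close>

subsection \<open>Linear independence from dual functionals\<close>

lemma (in vector_space) independent_image_if_dual:
  assumes fin: "finite S"
    and dual: "\<And>s. s \<in> S \<Longrightarrow>
      \<exists>\<phi>. module_hom scale (*) \<phi> \<and> \<phi> (b s) \<noteq> 0 \<and> (\<forall>t\<in>S - {s}. \<phi> (b t) = 0)"
  shows "inj_on b S" and "independent (b ` S)"
proof -
  show inj: "inj_on b S"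
    by (rule inj_onI) (metis DiffI dual singletonD)
  show "independent (b ` S)"
  proof (rule independent_if_scalars_zero)
    fix c x assume zero: "(\<Sum>x\<in>b ` S. scale (c x) x) = 0" and "x \<in> b ` S"
    then obtain s where s: "s \<in> S" "x = b s"
      by blast
    then obtain \<phi> where \<phi>: "module_hom scale (*) \<phi>" "\<phi> (b s) \<noteq> 0" "\<forall>t\<in>S - {s}. \<phi> (b t) = 0"
      using dual by blast
    interpret \<phi>: module_hom scale "(*)" \<phi>
      by (rule \<phi>(1))
    have "0 = \<phi> (\<Sum>t\<in>S. scale (c (b t)) (b t))"
      using zero by (simp add: sum.reindex[OF inj] \<phi>.zero)
    also have "\<dots> = (\<Sum>t\<in>S. c (b t) * \<phi> (b t))"
      by (simp add: \<phi>.sum \<phi>.scale)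
    also have "\<dots> = (\<Sum>t\<in>{s}. c (b t) * \<phi> (b t))"
      using fin s(1) \<phi>(3) by (intro sum.mono_neutral_right) auto
    finally show "c x = 0"
      using \<phi>(2) s(2) by simp
  qed (use fin in simp)
qed

subsection \<open>Ring homomorphisms and evaluation of polynomials\<close>

locale comm_ring_hom =
  fixes h :: "'a::comm_ring_1 \<Rightarrow> 'b::comm_ring_1"
  assumes hom_add: "h (a + b) = h a + h b"
    and hom_mult: "h (a * b) = h a * h b"
    and hom_one: "h 1 = 1"
begin

lemma hom_zero: "h 0 = 0"
  using hom_add[of 0 0] by simp

lemma hom_uminus: "h (- a) = - h a"
  using hom_add[of a "- a"] by (simp add: hom_zero eq_neg_iff_add_eq_0 add.commute)

lemma hom_sum: "h (sum f A) = (\<Sum>i\<in>A. h (f i))"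
  by (induction A rule: infinite_finite_induct) (simp_all add: hom_zero hom_add)

lemma hom_prod: "h (prod f A) = (\<Prod>i\<in>A. h (f i))"
  by (induction A rule: infinite_finite_induct) (simp_all add: hom_one hom_mult)

lemma hom_det:
  fixes M :: "'a^'n^'n"
  shows "h (det M) = det (\<chi> i j. h (M $ i $ j))"
proof -
  have "h (of_int (sign p)) = of_int (sign p)" for p :: "'n \<Rightarrow> 'n"
    by (simp add: sign_def hom_one hom_uminus)
  then show ?thesis
    by (simp add: det_def hom_sum hom_mult hom_prod)
qed

end

definition poly_eval ::
    "('a::comm_ring_1 \<Rightarrow> 'b::comm_ring_1) \<Rightarrow> ('v::finite \<Rightarrow> 'b) \<Rightarrow> ('v, 'a) mpoly \<Rightarrow> 'b" where
  "poly_eval h x f = (\<Sum>m\<in>Poly_Mapping.keys f.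
    h (Poly_Mapping.lookup f m) * (\<Prod>v\<in>UNIV. x v ^ Poly_Mapping.lookup m v))"

lemma sum_single_lookup:
  "(\<Sum>m\<in>Poly_Mapping.keys f. Poly_Mapping.single m (Poly_Mapping.lookup f m)) = f"
  by (rule poly_mapping_eqI)
    (simp add: lookup_sum lookup_single when_def not_in_keys_iff_lookup_eq_zero)

context comm_ring_hom
begin

lemma poly_eval_superset:
  assumes "finite S" and "Poly_Mapping.keys f \<subseteq> S"
  shows "poly_eval h x f =
    (\<Sum>m\<in>S. h (Poly_Mapping.lookup f m) * (\<Prod>v\<in>UNIV. x v ^ Poly_Mapping.lookup m v))"
  unfolding poly_eval_def
  by (rule sum.mono_neutral_left) (use assms in \<open>auto simp: in_keys_iff hom_zero\<close>)

lemma poly_eval_single: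
  "poly_eval h x (Poly_Mapping.single m c) = h c * (\<Prod>v\<in>UNIV. x v ^ Poly_Mapping.lookup m v)"
  by (subst poly_eval_superset[of "{m}"]) simp_all

lemma poly_eval_mconst: "poly_eval h x (mconst c) = h c"
  by (simp add: mconst_def poly_eval_single)

lemma poly_eval_mvar: "poly_eval h x (mvar v) = x v"
proof -
  have "(\<Prod>w\<in>UNIV. x w ^ Poly_Mapping.lookup (Poly_Mapping.single v (1::nat)) w)
      = (\<Prod>w\<in>UNIV. if w = v then x w else 1)"
    by (rule prod.cong) (auto simp: lookup_single when_def)
  then show ?thesis
    by (simp add: mvar_def poly_eval_single hom_one)
qed

lemma comm_ring_hom_poly_eval:
  fixes x :: "'v::finite \<Rightarrow> 'b"
  shows "comm_ring_hom (poly_eval h x)"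
proof
  show add: "poly_eval h x (f + g) = poly_eval h x f + poly_eval h x g" for f g
  proof -
    have "Poly_Mapping.keys (f + g) \<subseteq> Poly_Mapping.keys f \<union> Poly_Mapping.keys g"
      by (rule keys_add)
    then show ?thesis
      by (simp add: poly_eval_superset[of "Poly_Mapping.keys f \<union> Poly_Mapping.keys g"]
          lookup_add hom_add distrib_right sum.distrib)
  qed
  have sum: "poly_eval h x (sum f A) = (\<Sum>i\<in>A. poly_eval h x (f i))"
    for A and f :: "('v \<Rightarrow>\<^sub>0 nat) \<Rightarrow> ('v, 'a) mpoly"
    by (induction A rule: infinite_finite_induct) (simp_all add: add, simp_all add: poly_eval_def)
  have single: "poly_eval h x (Poly_Mapping.single m c * Poly_Mapping.single n d)
      = poly_eval h x (Poly_Mapping.single m c) * poly_eval h x (Poly_Mapping.single n d)" for m c n d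
    by (simp add: mult_single poly_eval_single hom_mult lookup_add power_add prod.distrib)
  show "poly_eval h x (f * g) = poly_eval h x f * poly_eval h x g" for f g
  proof -
    let ?s = "\<lambda>f m. Poly_Mapping.single m (Poly_Mapping.lookup f m)"
    have "poly_eval h x (sum (?s f) (Poly_Mapping.keys f) * sum (?s g) (Poly_Mapping.keys g))
        = poly_eval h x (sum (?s f) (Poly_Mapping.keys f)) *
          poly_eval h x (sum (?s g) (Poly_Mapping.keys g))"
      by (simp add: sum_product sum single)
    then show ?thesis
      by (simp only: sum_single_lookup)
  qed
  show "poly_eval h x 1 = 1"
    using poly_eval_mconst[of x 1] by (simp add: mconst_def hom_one)
qed

end

interpretation id_hom: comm_ring_hom "\<lambda>c. c"
  by standard simp_all

lemma meval_eq_poly_eval: "meval f x = poly_eval (\<lambda>c. c) x f"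
  by (simp add: meval_def poly_eval_def)

interpretation meval: comm_ring_hom "\<lambda>f. meval f x" for x
  unfolding meval_eq_poly_eval by (rule id_hom.comm_ring_hom_poly_eval)

lemma meval_mvar: "meval (mvar v) x = x v"
  by (simp add: meval_eq_poly_eval id_hom.poly_eval_mvar)

lemma meval_mconst: "meval (mconst c) x = c"
  by (simp add: meval_eq_poly_eval id_hom.poly_eval_mconst)

interpretation mconst: comm_ring_hom mconst
  by standard (simp_all add: mconst_def single_add mult_single)

lemma lookup_mconst_mult: "Poly_Mapping.lookup (mconst c * f) m = c * Poly_Mapping.lookup f m"
  unfolding mconst_def by (simp flip: mult_map_scale_conv_mult add: Poly_Mapping.map.rep_eq when_def)

subsection \<open>Determinants as functions of the rows\<close>

definition det_of_rows :: "('n::finite \<Rightarrow> 'a::comm_ring_1^'n) \<Rightarrow> 'a" where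
  "det_of_rows w = det (\<chi> i. w i)"

lemma det_of_rows_scale: "det_of_rows (w(k := c *s y)) = c * det_of_rows (w(k := y))"
  using det_row_mul[of k c "\<lambda>_. y" w] by (simp add: det_of_rows_def fun_upd_def)

lemma det_of_rows_sum:
  assumes "finite S"
  shows "det_of_rows (w(k := \<Sum>j\<in>S. y j)) = (\<Sum>j\<in>S. det_of_rows (w(k := y j)))"
  using det_linear_row_sum[OF assms, of k "\<lambda>_. y" w] by (simp add: det_of_rows_def fun_upd_def)

lemma det_of_rows_expand: "det_of_rows (w(k := y)) = (\<Sum>j\<in>UNIV. y $ j * det_of_rows (w(k := axis j 1)))"
proof -
  have "det_of_rows (w(k := y)) = det_of_rows (w(k := \<Sum>j\<in>UNIV. y $ j *s axis j 1))"
    by (simp add: basis_expansion)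
  then show ?thesis
    by (simp add: det_of_rows_sum det_of_rows_scale)
qed

lemma det_of_rows_eq_0: "w i = w j \<Longrightarrow> i \<noteq> j \<Longrightarrow> det_of_rows w = 0"
  unfolding det_of_rows_def by (rule det_identical_rows[of i j]) (simp_all add: row_def)

lemma det_of_rows_permute:
  assumes "\<sigma> permutes UNIV"
  shows "det_of_rows (w \<circ> \<sigma>) = of_int (sign \<sigma>) * det_of_rows w"
  using det_permute_rows[OF assms, of "\<chi> i. w i"] by (simp add: det_of_rows_def)

lemma prod_sum_UNIV:
  fixes F :: "'c::finite \<Rightarrow> 'n::finite \<Rightarrow> 'a::comm_ring_1"
  shows "(\<Prod>c\<in>UNIV. \<Sum>j\<in>UNIV. F c j) = (\<Sum>I\<in>UNIV. \<Prod>c\<in>UNIV. F c (I c))"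
  using prod_sum_PiE[of UNIV "\<lambda>_. UNIV" F] by simp

lemma det_of_rows_sum_rows:
  fixes a :: "'n::finite \<Rightarrow> 'm::finite \<Rightarrow> 'a::comm_ring_1^'n"
  shows "det_of_rows (\<lambda>i. \<Sum>j\<in>UNIV. a i j) = (\<Sum>f\<in>UNIV. det_of_rows (\<lambda>i. a i (f i)))"
proof -
  have "det_of_rows (\<lambda>i. \<Sum>j\<in>UNIV. a i j)
      = (\<Sum>\<sigma> | \<sigma> permutes UNIV. \<Sum>f\<in>UNIV. of_int (sign \<sigma>) * (\<Prod>i\<in>UNIV. a i (f i) $ \<sigma> i))"
    by (simp add: det_of_rows_def det_def prod_sum_UNIV sum_distrib_left)
  also have "\<dots> = (\<Sum>f\<in>UNIV. det_of_rows (\<lambda>i. a i (f i)))"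
    by (subst sum.swap) (simp add: det_of_rows_def det_def)
  finally show ?thesis .
qed

definition index_sign :: "('n::finite \<Rightarrow> 'n) \<Rightarrow> 'a::comm_ring_1" where
  "index_sign f = det_of_rows (\<lambda>t. axis (f t) 1)"

lemma index_sign_id: "index_sign (id :: 'n::finite \<Rightarrow> 'n) = (1 :: 'a::comm_ring_1)"
proof -
  have "(\<chi> t. axis t 1) = (mat 1 :: 'a^'n^'n)"
    by (simp add: vec_eq_iff mat_def axis_def)
  then show ?thesis
    by (simp add: index_sign_def det_of_rows_def)
qed

lemma index_sign_permute:
  assumes "\<tau> permutes UNIV"
  shows "index_sign (f \<circ> \<tau>) = of_int (sign \<tau>) * index_sign f"
  using det_of_rows_permute[OF assms, of "\<lambda>t. axis (f t) 1"] by (simp add: index_sign_def comp_def)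

lemma det_unit_row_eq_unit_column:
  "det_of_rows (w(i := axis k 1)) =
    det (\<chi> m n. if n = k then (if m = i then 1 else 0) else w m $ n)" (is "_ = det ?C")
  unfolding det_of_rows_def det_def
proof (intro sum.cong refl arg_cong2[where f = "(*)"])
  let ?R = "\<chi> m. (w(i := axis k 1)) m"
  fix \<sigma> :: "'b \<Rightarrow> 'b" assume "\<sigma> \<in> {\<sigma>. \<sigma> permutes UNIV}"
  then have \<sigma>: "bij \<sigma>"
    by (simp add: permutes_bij)
  show "(\<Prod>m\<in>UNIV. ?R $ m $ \<sigma> m) = (\<Prod>m\<in>UNIV. ?C $ m $ \<sigma> m)"
  proof (cases "\<sigma> i = k")
    case True
    then have "\<sigma> m = k \<longleftrightarrow> m = i" for m
      using \<sigma> by (metis bij_pointE)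
    then show ?thesis
      by (intro prod.cong) (auto simp: axis_def)
  next
    case False
    obtain m where "\<sigma> m = k"
      using \<sigma> by (metis bij_pointE)
    then have "?R $ i $ \<sigma> i = 0" and "?C $ m $ \<sigma> m = 0"
      using False by (auto simp: axis_def)
    then have "(\<Prod>m\<in>UNIV. ?R $ m $ \<sigma> m) = 0" and "(\<Prod>m\<in>UNIV. ?C $ m $ \<sigma> m) = 0"
      by (blast intro: prod_zero[OF finite])+
    then show ?thesis
      by simp
  qed
qed

lemma laplace_column:
  "det (\<chi> m n. if n = k then y m else w m $ n) = (\<Sum>i\<in>UNIV. y i * det_of_rows (w(i := axis k 1)))"
proof -
  let ?W = "\<lambda>n. \<chi> m. w m $ n"
  have transpose: "det_of_rows (?W(k := \<chi> m. y m)) = det (\<chi> m n. if n = k then y m else w m $ n)" for y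
  proof -
    have "(\<chi> n. (?W(k := \<chi> m. y m)) n) = transpose (\<chi> m n. if n = k then y m else w m $ n)"
      by (simp add: transpose_def vec_eq_iff)
    then show ?thesis
      by (simp add: det_of_rows_def)
  qed
  have "det_of_rows (?W(k := axis i 1)) = det_of_rows (w(i := axis k 1))" for i
    unfolding det_unit_row_eq_unit_column[of w] transpose[symmetric] by (simp add: axis_def)
  then show ?thesis
    using det_of_rows_expand[of ?W k "\<chi> m. y m"] by (simp add: transpose)
qed

lemma cramer_rule: "(\<Sum>i\<in>UNIV. det_of_rows (w(i := y)) *s w i) = det_of_rows w *s y"
proof (rule iffD2[OF vec_eq_iff], rule allI)
  fix n
  have "(\<Sum>i\<in>UNIV. det_of_rows (w(i := y)) * w i $ n)
      = (\<Sum>i\<in>UNIV. \<Sum>k\<in>UNIV. y $ k * (w i $ n * det_of_rows (w(i := axis k 1))))"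
    by (subst det_of_rows_expand) (simp add: sum_distrib_right sum_distrib_left mult_ac)
  also have "\<dots> = (\<Sum>k\<in>UNIV. y $ k * (\<Sum>i\<in>UNIV. w i $ n * det_of_rows (w(i := axis k 1))))"
    by (subst sum.swap) (simp add: sum_distrib_left)
  also have "\<dots> = (\<Sum>k\<in>UNIV. y $ k * det (\<chi> m l. if l = k then w m $ n else w m $ l))"
    by (simp flip: laplace_column)
  also have "\<dots> = (\<Sum>k\<in>UNIV. if k = n then y $ k * det_of_rows w else 0)"
  proof (intro sum.cong refl)
    fix k
    let ?A = "\<chi> m l. if l = k then w m $ n else w m $ l"
    show "y $ k * det ?A = (if k = n then y $ k * det_of_rows w else 0)"
    proof (cases "k = n")
      case True
      then have "?A = (\<chi> m. w m)"
        by (simp add: vec_eq_iff)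
      then show ?thesis
        using True by (simp add: det_of_rows_def)
    next
      case False
      then have "det ?A = 0"
        by (intro det_identical_columns[of k n]) (simp_all add: column_def)
      then show ?thesis
        using False by simp
    qed
  qed
  finally show "(\<Sum>i\<in>UNIV. det_of_rows (w(i := y)) *s w i) $ n = (det_of_rows w *s y) $ n"
    by (simp add: mult.commute)
qed

lemma pluecker_exchange:
  "det_of_rows w * det_of_rows z = (\<Sum>i\<in>UNIV. det_of_rows (w(i := z k)) * det_of_rows (z(k := w i)))"
proof -
  have "det_of_rows w * det_of_rows z = det_of_rows (z(k := det_of_rows w *s z k))"
    by (simp add: det_of_rows_scale)
  also have "\<dots> = det_of_rows (z(k := \<Sum>i\<in>UNIV. det_of_rows (w(i := z k)) *s w i))"
    by (simp only: cramer_rule)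
  also have "\<dots> = (\<Sum>i\<in>UNIV. det_of_rows (w(i := z k)) * det_of_rows (z(k := w i)))"
    by (simp add: det_of_rows_sum det_of_rows_scale)
  finally show ?thesis .
qed

lemma pluecker_three_term:
  fixes w :: "'n::finite \<Rightarrow> 'a::comm_ring_1^'n"
  assumes "i \<noteq> j"
  defines "\<omega> \<equiv> \<lambda>y z. det_of_rows (w(i := y, j := z))"
  shows "\<omega> y1 y2 * \<omega> z1 z2 = \<omega> y1 z1 * \<omega> y2 z2 - \<omega> y1 z2 * \<omega> y2 z1"
proof -
  let ?y = "w(i := y1, j := y2)" and ?z = "w(i := z1, j := z2)"
  let ?t = "\<lambda>c. det_of_rows (?y(c := z1)) * det_of_rows (?z(i := ?y c))"
  have alternating: "\<omega> z y = - \<omega> y z" for y z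
  proof -
    have "w(i := z, j := y) = w(i := y, j := z) \<circ> Transposition.transpose i j"
      using assms(1) by (auto simp: fun_eq_iff Transposition.transpose_def)
    then show ?thesis
      using assms(1) by (simp add: \<omega>_def det_of_rows_permute permutes_swap_id sign_swap_id)
  qed
  have "?t c = 0" if "c \<notin> {i, j}" for c
    using det_of_rows_eq_0[of "?z(i := ?y c)" i c] that assms(1) by auto
  then have "(\<Sum>c\<in>UNIV. ?t c) = (\<Sum>c\<in>{i, j}. ?t c)"
    by (intro sum.mono_neutral_right) auto
  also have "\<dots> = \<omega> z1 y2 * \<omega> y1 z2 + \<omega> y1 z1 * \<omega> y2 z2"
    using assms(1) by (simp add: \<omega>_def fun_upd_twist)
  finally show ?thesis
    using pluecker_exchange[of ?y ?z i] assms(1)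
    by (simp add: \<omega>_def alternating[unfolded \<omega>_def, of y2 z1] algebra_simps)
qed

lemma det_3_eq_0_if_pluecker:
  fixes \<omega> :: "'b \<Rightarrow> 'b \<Rightarrow> 'a::comm_ring_1" and y z :: "3 \<Rightarrow> 'b"
  assumes three_term: "\<And>y1 y2 z1 z2. \<omega> y1 y2 * \<omega> z1 z2 = \<omega> y1 z1 * \<omega> y2 z2 - \<omega> y1 z2 * \<omega> y2 z1"
  shows "det (\<chi> p q. \<omega> (y p) (z q)) = 0"
proof -
  have "det (\<chi> p q. \<omega> (y p) (z q)) =
      \<omega> (y 3) (z 1) * (\<omega> (y 1) (z 2) * \<omega> (y 2) (z 3) - \<omega> (y 1) (z 3) * \<omega> (y 2) (z 2))
    - \<omega> (y 3) (z 2) * (\<omega> (y 1) (z 1) * \<omega> (y 2) (z 3) - \<omega> (y 1) (z 3) * \<omega> (y 2) (z 1))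
    + \<omega> (y 3) (z 3) * (\<omega> (y 1) (z 1) * \<omega> (y 2) (z 2) - \<omega> (y 1) (z 2) * \<omega> (y 2) (z 1))"
    by (simp add: det_3 algebra_simps)
  also have "\<dots> = \<omega> (y 1) (y 2) *
      (\<omega> (y 3) (z 1) * \<omega> (z 2) (z 3) - \<omega> (y 3) (z 2) * \<omega> (z 1) (z 3) + \<omega> (y 3) (z 3) * \<omega> (z 1) (z 2))"
    by (simp only: three_term[symmetric]) (simp add: algebra_simps)
  also have "\<dots> = 0"
    using three_term[of "y 3" "z 1" "z 2" "z 3"] by simp
  finally show ?thesis .
qed

subsection \<open>Tensors as multilinear forms\<close>

definition contract :: "(('c::finite \<Rightarrow> 'n::finite) \<Rightarrow> 'a::comm_ring_1) \<Rightarrow> ('c \<Rightarrow> 'a^'n) \<Rightarrow> 'a" where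
  "contract T w = (\<Sum>I\<in>UNIV. (\<Prod>c\<in>UNIV. w c $ I c) * T I)"

lemma contract_det_of_rows:
  "contract (\<lambda>I. det_of_rows (\<lambda>c. B c $ I c)) w = det_of_rows (\<lambda>c. w c v* B c)"
proof -
  have "w c v* B c = (\<Sum>j\<in>UNIV. w c $ j *s B c $ j)" for c
    by (simp add: vector_matrix_mult_def vec_eq_iff)
  then have "det_of_rows (\<lambda>c. w c v* B c) = (\<Sum>I\<in>UNIV. det_of_rows (\<lambda>c. w c $ I c *s B c $ I c))"
    by (simp add: det_of_rows_sum_rows)
  then show ?thesis
    by (simp add: contract_def det_of_rows_def det_rows_mul)
qed

definition factorwise_act ::
    "('c::finite \<Rightarrow> 'c) \<Rightarrow> ('c \<Rightarrow> 'a::comm_ring_1^'n::finite^'n) \<Rightarrow> (('c \<Rightarrow> 'n) \<Rightarrow> 'a) \<Rightarrow> ('c \<Rightarrow> 'n) \<Rightarrow> 'a" where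
  "factorwise_act \<pi> g T = (\<lambda>J. \<Sum>I\<in>UNIV. (\<Prod>c\<in>UNIV. g c $ J c $ I c) * T (I \<circ> \<pi>))"

lemma contract_factorwise_act:
  assumes "\<pi> permutes UNIV"
  shows "contract (factorwise_act \<pi> g T) w = contract T (\<lambda>c. w (\<pi> c) v* g (\<pi> c))"
proof -
  let ?v = "\<lambda>c. w c v* g c"
  have "contract (factorwise_act \<pi> g T) w
      = (\<Sum>J\<in>UNIV. \<Sum>I\<in>UNIV. (\<Prod>c\<in>UNIV. w c $ J c * g c $ J c $ I c) * T (I \<circ> \<pi>))"
    by (simp add: contract_def factorwise_act_def sum_distrib_left prod.distrib mult.assoc)
  also have "\<dots> = (\<Sum>I\<in>UNIV. (\<Sum>J\<in>UNIV. \<Prod>c\<in>UNIV. w c $ J c * g c $ J c $ I c) * T (I \<circ> \<pi>))"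
    by (subst sum.swap) (simp add: sum_distrib_right)
  also have "\<dots> = (\<Sum>I\<in>UNIV. (\<Prod>c\<in>UNIV. ?v c $ I c) * T (I \<circ> \<pi>))"
    by (simp add: vector_matrix_mult_def prod_sum_UNIV)
  also have "\<dots> = (\<Sum>I\<in>UNIV. (\<Prod>c\<in>UNIV. ?v (\<pi> c) $ (I \<circ> \<pi>) c) * T (I \<circ> \<pi>))"
    by (intro sum.cong refl arg_cong2[where f = "(*)"])
      (subst prod.permute[OF assms], simp add: comp_def)
  also have "\<dots> = contract T (\<lambda>c. ?v (\<pi> c))"
    unfolding contract_def
    by (rule sum.reindex_bij_witness[where i = "\<lambda>I. I \<circ> inv \<pi>" and j = "\<lambda>I. I \<circ> \<pi>"])
      (simp_all add: comp_assoc permutes_inv_o[OF assms])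
  finally show ?thesis .
qed

definition basis_sum ::
    "('c::finite \<Rightarrow> 't::finite \<Rightarrow> 'n::finite) \<Rightarrow> ('c \<Rightarrow> 'n) \<Rightarrow> 'a::comm_ring_1" where
  "basis_sum F I = (\<Sum>t\<in>UNIV. if I = (\<lambda>c. F c t) then 1 else 0)"

lemma contract_basis_sum: "contract (basis_sum F) w = (\<Sum>t\<in>UNIV. \<Prod>c\<in>UNIV. w c $ F c t)"
proof -
  have "contract (basis_sum F) w
      = (\<Sum>I\<in>UNIV. \<Sum>t\<in>UNIV. if I = (\<lambda>c. F c t) then \<Prod>c\<in>UNIV. w c $ I c else 0)"
    unfolding contract_def basis_sum_def sum_distrib_left by (intro sum.cong refl) simp
  also have "\<dots> = (\<Sum>t\<in>UNIV. \<Prod>c\<in>UNIV. w c $ F c t)"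
    by (subst sum.swap) simp
  finally show ?thesis .
qed

subsection \<open>The contracted matrix of a tensor with four factors\<close>

abbreviation at_factors :: "4 \<Rightarrow> 4 \<Rightarrow> 4 \<Rightarrow> 4 \<Rightarrow> 'b::zero \<Rightarrow> 'b \<Rightarrow> 'b \<Rightarrow> 'b \<Rightarrow> 4 \<Rightarrow> 'b" where
  "at_factors i j k l p q r s \<equiv> (\<lambda>_. 0)(i := p, j := q, k := r, l := s)"

definition contracted_matrix ::
    "(multi_index \<Rightarrow> 'a::comm_ring_1) \<Rightarrow> 4 \<Rightarrow> 4 \<Rightarrow> 4 \<Rightarrow> 4 \<Rightarrow> 'a^3 \<Rightarrow> 'a^3 \<Rightarrow> 'a^3^3" where
  "contracted_matrix T i j k l u v =
    (\<chi> p q. \<Sum>r\<in>UNIV. \<Sum>s\<in>UNIV. u $ r * v $ s * T (at_factors i j k l p q r s))"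

lemma UNIV_4_distinct:
  assumes "distinct [i, j, k, l :: 4]"
  shows "UNIV = {i, j, k, l}"
proof -
  have "card {i, j, k, l} = CARD(4)"
    using assms by simp
  then show ?thesis
    by (intro card_subset_eq[symmetric]) simp_all
qed

lemma prod_4_distinct:
  assumes "distinct [i, j, k, l :: 4]"
  shows "(\<Prod>c\<in>UNIV. F c) = F i * F j * F k * F l"
  unfolding UNIV_4_distinct[OF assms] using assms by (simp add: mult.assoc)

lemma sum_multi_index:
  fixes F :: "multi_index \<Rightarrow> 'a::comm_monoid_add"
  assumes "distinct [i, j, k, l]"
  shows "(\<Sum>I\<in>UNIV. F I) = (\<Sum>p\<in>UNIV. \<Sum>q\<in>UNIV. \<Sum>r\<in>UNIV. \<Sum>s\<in>UNIV. F (at_factors i j k l p q r s))"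
proof -
  have "(\<Sum>I\<in>UNIV. F I) = (\<Sum>(p, q, r, s)\<in>UNIV. F (at_factors i j k l p q r s))"
  proof (rule sum.reindex_bij_witness[where j = "\<lambda>I. (I i, I j, I k, I l)"
        and i = "\<lambda>(p, q, r, s). at_factors i j k l p q r s"])
    fix I :: multi_index
    have "c = i \<or> c = j \<or> c = k \<or> c = l" for c
      using UNIV_4_distinct[OF assms] by blast
    then show "(case (I i, I j, I k, I l) of (p, q, r, s) \<Rightarrow> at_factors i j k l p q r s) = I"
      by (auto simp: fun_eq_iff)
    then show "(case (I i, I j, I k, I l) of (p, q, r, s) \<Rightarrow> F (at_factors i j k l p q r s)) = F I"
      by simp
  qed (use assms in auto)
  then show ?thesis
    by (simp add: sum.cartesian_product flip: UNIV_Times_UNIV)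
qed

lemma contract_eq_bilinear:
  assumes "distinct [i, j, k, l]"
  shows "contract T w =
    (\<Sum>p\<in>UNIV. w i $ p * (\<Sum>q\<in>UNIV. w j $ q * contracted_matrix T i j k l (w k) (w l) $ p $ q))"
  using assms
  by (simp add: contract_def sum_multi_index[OF assms] prod_4_distinct[OF assms] contracted_matrix_def
      sum_distrib_left mult.assoc)

lemma contracted_matrix_eq_contract:
  assumes "distinct [i, j, k, l]"
  shows "contracted_matrix T i j k l u v $ p $ q =
    contract T (at_factors i j k l (axis p 1) (axis q 1) u v)"
  using assms unfolding contract_eq_bilinear[OF assms]
  by (simp add: axis_def if_distrib[where f = "\<lambda>x. x * _"] cong: if_cong)

lemma det_contracted_matrix_det_of_rows_eq_0:
  fixes B :: "4 \<Rightarrow> 'a::comm_ring_1^4^3"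
  assumes distinct: "distinct [i, j, k, l]"
  shows "det (contracted_matrix (\<lambda>I. det_of_rows (\<lambda>c. B c $ I c)) i j k l u v) = 0"
proof -
  let ?w = "\<lambda>c. at_factors i j k l 0 0 u v c v* B c"
  have "contracted_matrix (\<lambda>I. det_of_rows (\<lambda>c. B c $ I c)) i j k l u v $ p $ q
      = det_of_rows (?w(i := axis p 1 v* B i, j := axis q 1 v* B j))" for p q
    unfolding contracted_matrix_eq_contract[OF distinct] contract_det_of_rows
    using distinct by (intro arg_cong[where f = det_of_rows]) (auto simp: fun_eq_iff)
  then have "det (contracted_matrix (\<lambda>I. det_of_rows (\<lambda>c. B c $ I c)) i j k l u v)
      = det (\<chi> p q. det_of_rows (?w(i := axis p 1 v* B i, j := axis q 1 v* B j)))"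
    by (intro arg_cong[where f = det]) (simp add: vec_eq_iff)
  also have "\<dots> = 0"
    by (rule det_3_eq_0_if_pluecker[OF pluecker_three_term]) (use distinct in simp)
  finally show ?thesis .
qed

lemma det_contracted_matrix_factorwise_act:
  assumes distinct: "distinct [i, j, k, l]" and \<pi>: "\<pi> permutes UNIV"
  shows "det (contracted_matrix (factorwise_act \<pi> g T) i j k l u v) = det (g i) * det (g j) *
      det (contracted_matrix T (inv \<pi> i) (inv \<pi> j) (inv \<pi> k) (inv \<pi> l) (u v* g k) (v v* g l))"
    (is "det ?M = _ * det ?N")
proof -
  have distinct': "distinct [inv \<pi> i, inv \<pi> j, inv \<pi> k, inv \<pi> l]"
    using distinct permutes_inj[OF permutes_inv[OF \<pi>]] by (simp add: inj_eq)
  have "?M $ p $ q = (g i ** (?N ** transpose (g j))) $ p $ q" for p q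
  proof -
    let ?w = "at_factors i j k l (axis p 1) (axis q 1) u v"
    have "?M $ p $ q = contract T (\<lambda>c. ?w (\<pi> c) v* g (\<pi> c))"
      by (simp only: contracted_matrix_eq_contract[OF distinct] contract_factorwise_act[OF \<pi>])
    also have "\<dots> = (\<Sum>p'\<in>UNIV. g i $ p $ p' * (\<Sum>q'\<in>UNIV. g j $ q $ q' * ?N $ p' $ q'))"
      unfolding contract_eq_bilinear[OF distinct'] permutes_inverses[OF \<pi>]
      using distinct
      by (simp add: vector_matrix_mult_def axis_def if_distrib[where f = "\<lambda>x. x * _"] cong: if_cong)
    also have "\<dots> = (g i ** (?N ** transpose (g j))) $ p $ q"
      by (simp add: matrix_matrix_mult_def transpose_def mult.commute)
    finally show ?thesis .
  qed
  then have "?M = g i ** (?N ** transpose (g j))"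
    by (simp add: vec_eq_iff)
  then show ?thesis
    by (simp add: det_mul mult_ac)
qed

lemma det_contracted_matrix_basis_sum:
  assumes distinct: "distinct [i, j, k, l]"
  shows "det (contracted_matrix (basis_sum F) i j k l u v) =
    index_sign (F i) * index_sign (F j) * (\<Prod>t\<in>UNIV. u $ F k t * v $ F l t)"
proof -
  let ?E = "\<lambda>i. \<chi> t. axis (F i t) 1"
  let ?D = "\<chi> t. (u $ F k t * v $ F l t) *s axis (F j t) 1"
  have "contracted_matrix (basis_sum F) i j k l u v $ p $ q = (transpose (?E i) ** ?D) $ p $ q" for p q
    unfolding contracted_matrix_eq_contract[OF distinct] contract_basis_sum prod_4_distinct[OF distinct]
    using distinct by (auto simp: matrix_matrix_mult_def transpose_def axis_def intro!: sum.cong)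
  then have "contracted_matrix (basis_sum F) i j k l u v = transpose (?E i) ** ?D"
    by (simp add: vec_eq_iff)
  then show ?thesis
    by (simp add: det_mul det_rows_mul index_sign_def det_of_rows_def mult_ac)
qed

lemma contracted_matrix_swap_transpose:
  assumes "distinct [i, j, k, l]"
  shows "contracted_matrix T j i k l u v = transpose (contracted_matrix T i j k l u v)"
  using assms by (auto simp: contracted_matrix_def transpose_def vec_eq_iff fun_upd_twist)

lemma (in comm_ring_hom) hom_det_contracted_matrix:
  "h (det (contracted_matrix T i j k l u v)) =
    det (contracted_matrix (\<lambda>I. h (T I)) i j k l (\<chi> r. h (u $ r)) (\<chi> s. h (v $ s)))"
  by (simp add: hom_det contracted_matrix_def hom_sum hom_mult)

lemma det_contracted_matrix_expand:
  "det (contracted_matrix T i j k l u v) = (\<Sum>r\<in>UNIV. \<Sum>s\<in>UNIV.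
    (\<Prod>p\<in>UNIV. u $ r p * v $ s p) * det (\<chi> p q. T (at_factors i j k l p q (r p) (s p))))"
proof -
  have "contracted_matrix T i j k l u v
      = (\<chi> p. \<Sum>r\<in>UNIV. \<Sum>s\<in>UNIV. (u $ r * v $ s) *s (\<chi> q. T (at_factors i j k l p q r s)))"
    by (simp add: contracted_matrix_def vec_eq_iff)
  then show ?thesis
    by (simp add: det_linear_rows_sum det_rows_mul)
qed

subsection \<open>Monomials in two groups of variables\<close>

definition range_mset :: "('p::finite \<Rightarrow> 'b) \<Rightarrow> 'b multiset" where
  "range_mset f = image_mset f (mset_set UNIV)"

lemma range_mset_permute: "\<tau> permutes UNIV \<Longrightarrow> range_mset (f \<circ> \<tau>) = range_mset f"
  unfolding range_mset_def
  by (metis bij_betw_def image_mset_mset_set multiset.map_comp permutes_bij)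

lemma range_range_mset:
  "range (range_mset :: ('p::finite \<Rightarrow> 'b) \<Rightarrow> 'b multiset) = multisets_of_size UNIV CARD('p)"
  (is "range ?f = _")
proof
  show "range ?f \<subseteq> multisets_of_size UNIV CARD('p)"
    by (auto simp: range_mset_def multisets_of_size_def)
  show "multisets_of_size UNIV CARD('p) \<subseteq> range ?f"
  proof
    fix M :: "'b multiset" assume "M \<in> multisets_of_size UNIV CARD('p)"
    then obtain xs where xs: "mset xs = M" "length xs = CARD('p)"
      by (metis ex_mset multisets_of_size_size size_mset)
    obtain \<iota> where "bij_betw \<iota> (UNIV :: 'p set) {0..<CARD('p)}"
      using ex_bij_betw_finite_nat[OF finite] by blast
    then have image: "image_mset \<iota> (mset_set UNIV) = mset_set {0..<length xs}"
      by (simp add: bij_betw_def image_mset_mset_set xs(2))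
    then have "range_mset (\<lambda>p. xs ! \<iota> p) = image_mset ((!) xs) (mset_set {0..<length xs})"
      by (simp add: range_mset_def multiset.map_comp comp_def flip: image)
    also have "\<dots> = mset (map ((!) xs) [0..<length xs])"
      by (simp only: mset_map mset_upt)
    also have "\<dots> = M"
      by (simp only: map_nth xs(1))
    finally show "M \<in> range ?f"
      by blast
  qed
qed

definition bimonomial :: "'b multiset \<Rightarrow> 'c multiset \<Rightarrow> ('b + 'c \<Rightarrow>\<^sub>0 nat)" where
  "bimonomial M N =
    (\<Sum>x\<in>#M. Poly_Mapping.single (Inl x) 1) + (\<Sum>y\<in>#N. Poly_Mapping.single (Inr y) 1)"

lemma lookup_bimonomial:
  "Poly_Mapping.lookup (bimonomial M N) (Inl x) = count M x"
  "Poly_Mapping.lookup (bimonomial M N) (Inr y) = count N y"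
proof -
  have "Poly_Mapping.lookup (\<Sum>x\<in>#M. Poly_Mapping.single (Inl x) (1::nat)) z =
      (case z of Inl x \<Rightarrow> count M x | Inr _ \<Rightarrow> 0)" for z :: "'a + 'b"
    by (induction M) (auto simp: lookup_add lookup_single when_def split: sum.split)
  moreover have "Poly_Mapping.lookup (\<Sum>y\<in>#N. Poly_Mapping.single (Inr y) (1::nat)) z =
      (case z of Inl _ \<Rightarrow> 0 | Inr y \<Rightarrow> count N y)" for z :: "'a + 'b"
    by (induction N) (auto simp: lookup_add lookup_single when_def split: sum.split)
  ultimately show "Poly_Mapping.lookup (bimonomial M N) (Inl x) = count M x"
    and "Poly_Mapping.lookup (bimonomial M N) (Inr y) = count N y"
    by (simp_all add: bimonomial_def lookup_add)
qed

lemma bimonomial_eq_iff: "bimonomial M N = bimonomial M' N' \<longleftrightarrow> M = M' \<and> N = N'"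
  by (metis lookup_bimonomial multiset_eqI)

lemma prod_mvar_eq_single_bimonomial:
  fixes r :: "'p::finite \<Rightarrow> 'b" and s :: "'p \<Rightarrow> 'c"
  shows "(\<Prod>p\<in>UNIV. mvar (Inl (r p)) * mvar (Inr (s p)))
    = Poly_Mapping.single (bimonomial (range_mset r) (range_mset s)) (1::'a::comm_ring_1)"
proof -
  have "(\<Prod>p\<in>P. mvar (Inl (r p)) * mvar (Inr (s p))) = Poly_Mapping.single
      (bimonomial (image_mset r (mset_set P)) (image_mset s (mset_set P))) (1::'a)" if "finite P" for P
    using that
    by (induction P) (simp_all add: mvar_def bimonomial_def mult_single add_ac)
  then show ?thesis
    by (simp add: range_mset_def)
qed

definition bicubic_monomials :: "(3 + 3 \<Rightarrow>\<^sub>0 nat) set" where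
  "bicubic_monomials =
    (\<lambda>(M, N). bimonomial M N) ` (multisets_of_size UNIV 3 \<times> multisets_of_size UNIV 3)"

lemma finite_bicubic_monomials: "finite bicubic_monomials"
  by (simp add: bicubic_monomials_def finite_multisets_of_size)

lemma card_bicubic_monomials: "card bicubic_monomials = 100"
proof -
  have "card (multisets_of_size (UNIV :: 3 set) 3) = 5 choose 3"
    using card_multisets_of_size[of "UNIV :: 3 set" 3] by simp
  also have "\<dots> = 10"
    by (simp add: eval_nat_numeral)
  finally show ?thesis
    unfolding bicubic_monomials_def
    by (subst card_image) (auto simp: inj_on_def bimonomial_eq_iff card_cartesian_product)
qed

lemma in_bicubic_monomials_iff:
  "m \<in> bicubic_monomials \<longleftrightarrow>
    (\<exists>(r :: 3 \<Rightarrow> 3) (s :: 3 \<Rightarrow> 3). m = bimonomial (range_mset r) (range_mset s))"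
proof -
  have "multisets_of_size UNIV 3 = range (range_mset :: (3 \<Rightarrow> 3) \<Rightarrow> 3 multiset)"
    using range_range_mset[where 'p = 3 and 'b = 3] by simp
  moreover have "m \<in> bicubic_monomials \<longleftrightarrow>
      (\<exists>M\<in>multisets_of_size UNIV 3. \<exists>N\<in>multisets_of_size UNIV 3. m = bimonomial M N)"
    by (auto simp: bicubic_monomials_def)
  ultimately show ?thesis
    by simp
qed

subsection \<open>Coefficients of the contracted determinant\<close>

definition contracted_form ::
    "(multi_index \<Rightarrow> 'a::comm_ring_1) \<Rightarrow> 4 \<Rightarrow> 4 \<Rightarrow> 4 \<Rightarrow> 4 \<Rightarrow> (3 + 3, 'a) mpoly" where
  "contracted_form T i j k l =
    det (contracted_matrix (\<lambda>I. mconst (T I)) i j k l (\<chi> r. mvar (Inl r)) (\<chi> s. mvar (Inr s)))"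

lemma det_form_eq_contracted_form: "det_form i j k l = contracted_form mvar i j k l"
  by (simp add: det_form_def contracted_form_def contracted_matrix_def)

definition mixed_minor ::
    "(multi_index \<Rightarrow> 'a::comm_ring_1) \<Rightarrow> 4 \<Rightarrow> 4 \<Rightarrow> 4 \<Rightarrow> 4 \<Rightarrow> (3 \<Rightarrow> 3) \<Rightarrow> (3 \<Rightarrow> 3) \<Rightarrow> 'a" where
  "mixed_minor T i j k l r s = det (\<chi> p q. T (at_factors i j k l p q (r p) (s p)))"

lemma contracted_form_expand:
  "contracted_form T i j k l = (\<Sum>r\<in>UNIV. \<Sum>s\<in>UNIV.
    Poly_Mapping.single (bimonomial (range_mset r) (range_mset s)) (mixed_minor T i j k l r s))"
proof -
  have "det (\<chi> p q. mconst (T (at_factors i j k l p q (r p) (s p))))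
      = (mconst (mixed_minor T i j k l r s) :: (3 + 3, 'a) mpoly)" for r s
    by (simp add: mixed_minor_def mconst.hom_det)
  moreover have "Poly_Mapping.single m 1 * mconst c = Poly_Mapping.single m c"
    for m :: "3 + 3 \<Rightarrow>\<^sub>0 nat" and c :: 'a
    by (simp add: mconst_def mult_single)
  ultimately show ?thesis
    by (simp add: contracted_form_def det_contracted_matrix_expand prod_mvar_eq_single_bimonomial)
qed

lemma lookup_contracted_form:
  "Poly_Mapping.lookup (contracted_form T i j k l) m = (\<Sum>r\<in>UNIV. \<Sum>s\<in>UNIV.
    if bimonomial (range_mset r) (range_mset s) = m then mixed_minor T i j k l r s else 0)"
  by (simp add: contracted_form_expand lookup_sum lookup_single when_def)

lemma keys_contracted_form: "Poly_Mapping.keys (contracted_form T i j k l) \<subseteq> bicubic_monomials"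
proof -
  have "Poly_Mapping.lookup (contracted_form T i j k l) m = 0" if "m \<notin> bicubic_monomials" for m
  proof -
    have "bimonomial (range_mset r) (range_mset s) \<noteq> m" for r s :: "3 \<Rightarrow> 3"
      using that by (auto simp: in_bicubic_monomials_iff)
    then show ?thesis
      by (simp add: lookup_contracted_form)
  qed
  then show ?thesis
    by (auto simp: in_keys_iff)
qed

lemma meval_coeff_det_form:
  "meval (Poly_Mapping.lookup (det_form i j k l) m) T =
    Poly_Mapping.lookup (contracted_form T i j k l) m"
proof -
  have "meval (mixed_minor mvar i j k l r s) T = mixed_minor T i j k l r s" for r s
    by (simp add: mixed_minor_def meval.hom_det meval_mvar)
  then show ?thesis
    unfolding det_form_eq_contracted_form lookup_contracted_form meval.hom_sum
    by (intro sum.cong refl) (simp add: meval.hom_zero)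
qed

lemma coeff_det_form_eq_0:
  "m \<notin> bicubic_monomials \<Longrightarrow> Poly_Mapping.lookup (det_form i j k l) m = 0"
  unfolding det_form_eq_contracted_form by (meson in_keys_iff keys_contracted_form subsetD)

lemma lookup_contracted_form_swap_contracted:
  assumes "distinct [i, j, k, l]"
  shows "Poly_Mapping.lookup (contracted_form T i j l k) (bimonomial M N)
    = Poly_Mapping.lookup (contracted_form T i j k l) (bimonomial N M)"
proof -
  have minor: "mixed_minor T i j l k r s = mixed_minor T i j k l s r" for r s
  proof -
    have "at_factors i j l k p q (r p) (s p) = at_factors i j k l p q (s p) (r p)" for p q
      using assms by (auto simp: fun_eq_iff)
    then show ?thesis
      by (simp add: mixed_minor_def)
  qed
  have "Poly_Mapping.lookup (contracted_form T i j l k) (bimonomial M N) = (\<Sum>r\<in>UNIV. \<Sum>s\<in>UNIV.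
      if bimonomial (range_mset s) (range_mset r) = bimonomial N M
      then mixed_minor T i j k l s r else 0)"
    unfolding lookup_contracted_form minor
    by (intro sum.cong refl if_cong) (auto simp: bimonomial_eq_iff)
  also have "\<dots> = Poly_Mapping.lookup (contracted_form T i j k l) (bimonomial N M)"
    unfolding lookup_contracted_form by (rule sum.swap)
  finally show ?thesis .
qed

lemma quadrifocal_of_eq_det_of_rows: "quadrifocal_of A I = det_of_rows (\<lambda>c. A c $ I c)"
proof -
  have "quadrifocal_of A I = det (transpose (\<chi> c. A c $ I c))"
    by (simp add: quadrifocal_of_def block_matrix_def transpose_def)
  then show ?thesis
    by (simp add: det_of_rows_def)
qed

lemma contracted_form_quadrifocal_of_eq_0:
  assumes "distinct [i, j, k, l]"
  shows "contracted_form (quadrifocal_of A) i j k l = 0"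
proof -
  let ?B = "\<lambda>c. (\<chi> p m. mconst (A c $ p $ m)) :: (3 + 3, complex) mpoly^4^3"
  have "mconst (quadrifocal_of A I) = det_of_rows (\<lambda>c. ?B c $ I c)" for I
    by (simp add: quadrifocal_of_eq_det_of_rows det_of_rows_def mconst.hom_det)
  then show ?thesis
    by (simp only: contracted_form_def det_contracted_matrix_det_of_rows_eq_0[OF assms])
qed

definition block_substitution :: "'a^3^3 \<Rightarrow> 'a^3^3 \<Rightarrow> 3 + 3 \<Rightarrow> (3 + 3, 'a::comm_ring_1) mpoly" where
  "block_substitution G H = case_sum (\<lambda>r'. \<Sum>r\<in>UNIV. mvar (Inl r) * mconst (G $ r $ r'))
    (\<lambda>s'. \<Sum>s\<in>UNIV. mvar (Inr s) * mconst (H $ s $ s'))"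

lemma contracted_form_tensor_act:
  fixes g :: "4 \<Rightarrow> complex^3^3"
  assumes distinct: "distinct [i, j, k, l]" and \<pi>: "\<pi> permutes UNIV"
  shows "contracted_form (tensor_act \<pi> g T) i j k l = mconst (det (g i) * det (g j)) *
    poly_eval mconst (block_substitution (g k) (g l))
      (contracted_form T (inv \<pi> i) (inv \<pi> j) (inv \<pi> k) (inv \<pi> l))"
proof -
  let ?G = "\<lambda>c. (\<chi> p q. mconst (g c $ p $ q)) :: (3 + 3, complex) mpoly^3^3"
  let ?\<alpha> = "block_substitution (g k) (g l)"
  interpret substitution: comm_ring_hom "poly_eval mconst ?\<alpha>"
    by (rule mconst.comm_ring_hom_poly_eval)
  have \<alpha>: "(\<chi> r. ?\<alpha> (Inl r)) = (\<chi> r. mvar (Inl r)) v* ?G k"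
    "(\<chi> s. ?\<alpha> (Inr s)) = (\<chi> s. mvar (Inr s)) v* ?G l"
    by (simp_all add: block_substitution_def vector_matrix_mult_def vec_eq_iff)
  have "mconst (tensor_act \<pi> g T J) = factorwise_act \<pi> ?G (\<lambda>I. mconst (T I)) J" for J
    by (simp add: tensor_act_def factorwise_act_def mconst.hom_sum mconst.hom_mult mconst.hom_prod)
  then have "contracted_form (tensor_act \<pi> g T) i j k l = det (?G i) * det (?G j) *
      det (contracted_matrix (\<lambda>I. mconst (T I)) (inv \<pi> i) (inv \<pi> j) (inv \<pi> k) (inv \<pi> l)
        (\<chi> r. ?\<alpha> (Inl r)) (\<chi> s. ?\<alpha> (Inr s)))"
    unfolding contracted_form_def \<alpha> by (simp only: det_contracted_matrix_factorwise_act[OF distinct \<pi>])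
  then show ?thesis
    by (simp add: contracted_form_def substitution.hom_det_contracted_matrix mconst.poly_eval_mconst
        mconst.poly_eval_mvar mconst.hom_mult mconst.hom_det)
qed

lemma lookup_contracted_form_tensor_act:
  assumes distinct: "distinct [i, j, k, l]" and \<pi>: "\<pi> permutes UNIV"
  shows "Poly_Mapping.lookup (contracted_form (tensor_act \<pi> g T) i j k l) n = (\<Sum>m\<in>bicubic_monomials.
    det (g i) * det (g j) *
      Poly_Mapping.lookup (\<Prod>v\<in>UNIV. block_substitution (g k) (g l) v ^ Poly_Mapping.lookup m v) n *
      Poly_Mapping.lookup (contracted_form T (inv \<pi> i) (inv \<pi> j) (inv \<pi> k) (inv \<pi> l)) m)"
  unfolding contracted_form_tensor_act[OF distinct \<pi>]
    mconst.poly_eval_superset[OF finite_bicubic_monomials keys_contracted_form]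
  by (simp add: lookup_mconst_mult lookup_sum sum_distrib_left) (simp only: mult_ac)

subsection \<open>The module of cubic forms\<close>

lemma subspace_cubic_forms: "tpoly.subspace cubic_forms"
proof (rule tpoly.subspaceI)
  show "f + g \<in> cubic_forms" if "f \<in> cubic_forms" "g \<in> cubic_forms" for f g
    using that keys_add[of f g] by (auto simp: cubic_forms_def)
  show "mconst c * f \<in> cubic_forms" if "f \<in> cubic_forms" for c f
    using that by (auto simp: cubic_forms_def in_keys_iff lookup_mconst_mult)
qed (simp add: cubic_forms_def)

lemma prod_mvar_cubic:
  fixes f :: "3 \<Rightarrow> multi_index"
  shows "(\<Prod>p\<in>UNIV. mvar (f p)) \<in> cubic_forms"
proof -
  have "(\<Prod>p\<in>P. mvar (f p) :: tensor_poly)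
      = Poly_Mapping.single (\<Sum>p\<in>P. Poly_Mapping.single (f p) 1) 1" for P
    by (induction P rule: infinite_finite_induct) (simp_all add: mvar_def mult_single)
  moreover have "(\<Sum>I\<in>UNIV. Poly_Mapping.lookup (\<Sum>p\<in>UNIV. Poly_Mapping.single (f p) (1::nat)) I) = 3"
    unfolding lookup_sum by (subst sum.swap) (simp add: lookup_single when_def)
  ultimately show ?thesis
    by (simp add: cubic_forms_def)
qed

lemma det_mvar_cubic:
  fixes f :: "3 \<Rightarrow> 3 \<Rightarrow> multi_index"
  shows "det (\<chi> p q. mvar (f p q)) \<in> cubic_forms"
proof -
  have "of_int (sign \<sigma>) * (\<Prod>p\<in>UNIV. mvar (f p (\<sigma> p))) \<in> cubic_forms" for \<sigma> :: "3 \<Rightarrow> 3"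
    using tpoly.subspace_scale[OF subspace_cubic_forms prod_mvar_cubic, of "of_int (sign \<sigma>)"]
    by (simp add: mconst_def)
  then show ?thesis
    unfolding det_def by (auto intro!: tpoly.subspace_sum[OF subspace_cubic_forms])
qed

lemma coeff_det_form_cubic: "Poly_Mapping.lookup (det_form i j k l) m \<in> cubic_forms"
  unfolding det_form_eq_contracted_form lookup_contracted_form
  by (intro tpoly.subspace_sum[OF subspace_cubic_forms])
    (auto simp: mixed_minor_def det_mvar_cubic tpoly.subspace_0[OF subspace_cubic_forms])

lemma subspace_S3_S3_S111_S111: "tpoly.subspace S3_S3_S111_S111"
  by (simp add: S3_S3_S111_S111_def)

lemma coeff_det_form_in_summand: "Poly_Mapping.lookup (det_form i j k l) m \<in> summand i j k l"
  by (simp add: summand_def tpoly.span_base)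

lemma coeff_det_form_in_S3_S3_S111_S111:
  "distinct [i, j, k, l] \<Longrightarrow> Poly_Mapping.lookup (det_form i j k l) m \<in> S3_S3_S111_S111"
  unfolding S3_S3_S111_S111_def by (rule tpoly.span_base) (use coeff_det_form_in_summand in blast)

lemma S3_S3_S111_S111_least:
  assumes subspace: "tpoly.subspace V"
    and coeffs: "\<And>i j k l m. distinct [i, j, k, l] \<Longrightarrow> Poly_Mapping.lookup (det_form i j k l) m \<in> V"
  shows "S3_S3_S111_S111 \<subseteq> V"
  unfolding S3_S3_S111_S111_def
proof (rule tpoly.span_minimal[OF _ subspace])
  have "summand i j k l \<subseteq> V" if "distinct [i, j, k, l]" for i j k l
    unfolding summand_def using coeffs[OF that] by (intro tpoly.span_minimal[OF _ subspace]) auto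
  then show "\<Union> {summand i j k l | i j k l. distinct [i, j, k, l]} \<subseteq> V"
    by blast
qed

lemma S3_S3_S111_S111_cubic: "S3_S3_S111_S111 \<subseteq> cubic_forms"
  by (rule S3_S3_S111_S111_least[OF subspace_cubic_forms coeff_det_form_cubic])

lemma S3_S3_S111_S111_vanish_quadrifocal:
  assumes "quadrifocal Q" and "f \<in> S3_S3_S111_S111"
  shows "meval f Q = 0"
proof -
  have "S3_S3_S111_S111 \<subseteq> {f. meval f Q = 0}"
  proof (rule S3_S3_S111_S111_least)
    show "tpoly.subspace {f. meval f Q = 0}"
      by (rule tpoly.subspaceI) (simp_all add: meval.hom_zero meval.hom_add meval.hom_mult)
    show "Poly_Mapping.lookup (det_form i j k l) m \<in> {f. meval f Q = 0}"
      if "distinct [i, j, k, l]" for i j k l m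
      using assms(1) contracted_form_quadrifocal_of_eq_0[OF that]
      by (auto simp: quadrifocal_def meval_coeff_det_form)
  qed
  then show ?thesis
    using assms(2) by blast
qed

lemma subspace_pullback:
  assumes W: "tpoly.subspace W"
  shows "tpoly.subspace {f. \<exists>h\<in>W. \<forall>T. meval h T = meval f (\<phi> T)}" (is "tpoly.subspace ?V")
proof (rule tpoly.subspaceI)
  show "0 \<in> ?V"
    using tpoly.subspace_0[OF W] by (auto simp: meval.hom_zero intro!: bexI[of _ 0])
  fix f assume "f \<in> ?V"
  then obtain h where h: "h \<in> W" "\<forall>T. meval h T = meval f (\<phi> T)"
    by blast
  show "mconst c * f \<in> ?V" for c
    using h
    by (auto simp: meval.hom_mult meval_mconst intro!: bexI[of _ "mconst c * h"] tpoly.subspace_scale[OF W])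
  fix f' assume "f' \<in> ?V"
  then obtain h' where "h' \<in> W" "\<forall>T. meval h' T = meval f' (\<phi> T)"
    by blast
  with h show "f + f' \<in> ?V"
    by (auto simp: meval.hom_add intro!: bexI[of _ "h + h'"] tpoly.subspace_add[OF W])
qed

lemma coeff_det_form_tensor_act:
  assumes distinct: "distinct [i, j, k, l]" and \<pi>: "\<pi> permutes UNIV"
  shows "\<exists>h\<in>S3_S3_S111_S111. \<forall>T. meval h T =
    meval (Poly_Mapping.lookup (det_form i j k l) n) (tensor_act \<pi> g T)"
proof (intro bexI allI)
  let ?D = "det_form (inv \<pi> i) (inv \<pi> j) (inv \<pi> k) (inv \<pi> l)"
  let ?c = "\<lambda>m. det (g i) * det (g j) *
    Poly_Mapping.lookup (\<Prod>v\<in>UNIV. block_substitution (g k) (g l) v ^ Poly_Mapping.lookup m v) n"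
  let ?h = "\<Sum>m\<in>bicubic_monomials. mconst (?c m) * Poly_Mapping.lookup ?D m"
  show "meval ?h T = meval (Poly_Mapping.lookup (det_form i j k l) n) (tensor_act \<pi> g T)" for T
    by (simp only: meval.hom_sum meval.hom_mult meval_mconst meval_coeff_det_form
        lookup_contracted_form_tensor_act[OF distinct \<pi>])
  have "distinct [inv \<pi> i, inv \<pi> j, inv \<pi> k, inv \<pi> l]"
    using distinct permutes_inj[OF permutes_inv[OF \<pi>]] by (simp add: inj_eq)
  then show "?h \<in> S3_S3_S111_S111"
    by (intro tpoly.subspace_sum tpoly.subspace_scale subspace_S3_S3_S111_S111
        coeff_det_form_in_S3_S3_S111_S111)
qed

lemma G_submodule_S3_S3_S111_S111: "G_submodule S3_S3_S111_S111"
  unfolding G_submodule_def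
proof (intro conjI allI impI subspace_S3_S3_S111_S111)
  fix \<pi> :: "4 \<Rightarrow> 4" and g :: "4 \<Rightarrow> complex^3^3"
  assume "\<pi> permutes UNIV"
  then have "S3_S3_S111_S111 \<subseteq> {f. \<exists>h\<in>S3_S3_S111_S111. \<forall>T. meval h T = meval f (tensor_act \<pi> g T)}"
    using coeff_det_form_tensor_act
    by (intro S3_S3_S111_S111_least subspace_pullback subspace_S3_S3_S111_S111) simp
  then show "\<forall>f\<in>S3_S3_S111_S111. \<exists>h\<in>S3_S3_S111_S111. \<forall>T. meval h T = meval f (tensor_act \<pi> g T)"
    by blast
qed

subsection \<open>The dimension\<close>

definition splittings :: "(4 \<times> 4 \<times> 4 \<times> 4) set" where
  "splittings = {(1, 2, 3, 4), (1, 3, 2, 4), (1, 4, 2, 3), (2, 3, 1, 4), (2, 4, 1, 3), (3, 4, 1, 2)}"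

definition coeff_of_splitting :: "(4 \<times> 4 \<times> 4 \<times> 4) \<times> (3 + 3 \<Rightarrow>\<^sub>0 nat) \<Rightarrow> tensor_poly" where
  "coeff_of_splitting = (\<lambda>((i, j, k, l), m). Poly_Mapping.lookup (det_form i j k l) m)"

lemma distinct_if_splitting: "(i, j, k, l) \<in> splittings \<Longrightarrow> distinct [i, j, k, l]"
  by (auto simp: splittings_def)

lemma summand_swap_uncontracted:
  "distinct [i, j, k, l] \<Longrightarrow> summand j i k l = summand i j k l"
  by (simp add: summand_def det_form_eq_contracted_form contracted_form_def
      contracted_matrix_swap_transpose)

lemma summand_swap_contracted:
  assumes "distinct [i, j, k, l]"
  shows "summand i j l k = summand i j k l"
proof -
  have "summand i j l k \<subseteq> summand i j k l" if "distinct [i, j, k, l]" for k l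
  proof -
    have "Poly_Mapping.lookup (det_form i j l k) m \<in> summand i j k l" for m
    proof (cases "m \<in> bicubic_monomials")
      case True
      then obtain M N where "m = bimonomial M N"
        by (auto simp: in_bicubic_monomials_iff)
      then show ?thesis
        using lookup_contracted_form_swap_contracted[OF that] coeff_det_form_in_summand
        by (metis det_form_eq_contracted_form)
    next
      case False
      then show ?thesis
        by (simp add: coeff_det_form_eq_0 summand_def tpoly.span_zero)
    qed
    then show ?thesis
      unfolding summand_def[of i j l k] by (intro tpoly.span_minimal) (auto simp: summand_def)
  qed
  from this[of k l] this[of l k] show ?thesis
    using assms by auto
qed

lemma summand_eq_splitting:
  assumes distinct: "distinct [i, j, k, l]"
  obtains i' j' k' l' where "(i', j', k', l') \<in> splittings"
    and "summand i j k l = summand i' j' k' l'"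
proof -
  have "(i, j, k, l) \<in> splittings \<or> (j, i, k, l) \<in> splittings \<or>
      (i, j, l, k) \<in> splittings \<or> (j, i, l, k) \<in> splittings"
    using distinct exhaust_4[of i] exhaust_4[of j] exhaust_4[of k] exhaust_4[of l]
    by (elim disjE) (simp_all add: splittings_def)
  moreover have "summand j i k l = summand i j k l" "summand i j l k = summand i j k l"
    "summand j i l k = summand i j k l"
    using distinct summand_swap_uncontracted[of i j k l] summand_swap_contracted[of i j k l]
      summand_swap_uncontracted[of i j l k] by auto
  ultimately show ?thesis
    using that by metis
qed

lemma summand_subset_span_splittings:
  assumes "(i, j, k, l) \<in> splittings"
  shows "summand i j k l \<subseteq> tpoly.span (coeff_of_splitting ` (splittings \<times> bicubic_monomials))"
    (is "_ \<subseteq> ?V")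
proof -
  have "Poly_Mapping.lookup (det_form i j k l) m \<in> ?V" for m
  proof (cases "m \<in> bicubic_monomials")
    case True
    then have "coeff_of_splitting ((i, j, k, l), m) \<in> ?V"
      using assms by (intro tpoly.span_base) blast
    then show ?thesis
      by (simp add: coeff_of_splitting_def)
  next
    case False
    then show ?thesis
      by (simp add: coeff_det_form_eq_0 tpoly.span_zero)
  qed
  then show ?thesis
    unfolding summand_def by (intro tpoly.span_minimal) auto
qed

lemma span_coeff_of_splitting:
  "tpoly.span (coeff_of_splitting ` (splittings \<times> bicubic_monomials)) = S3_S3_S111_S111"
proof (rule antisym)
  show "tpoly.span (coeff_of_splitting ` (splittings \<times> bicubic_monomials)) \<subseteq> S3_S3_S111_S111"
    by (rule tpoly.span_minimal[OF _ subspace_S3_S3_S111_S111])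
      (auto simp: coeff_of_splitting_def
        intro!: coeff_det_form_in_S3_S3_S111_S111[OF distinct_if_splitting])
  show "S3_S3_S111_S111 \<subseteq> tpoly.span (coeff_of_splitting ` (splittings \<times> bicubic_monomials))"
    (is "_ \<subseteq> ?V")
  proof (rule S3_S3_S111_S111_least[OF tpoly.subspace_span])
    fix i j k l :: 4 and m assume "distinct [i, j, k, l]"
    then obtain i' j' k' l' where "(i', j', k', l') \<in> splittings"
      and "summand i j k l = summand i' j' k' l'"
      by (rule summand_eq_splitting)
    then show "Poly_Mapping.lookup (det_form i j k l) m \<in> ?V"
      using coeff_det_form_in_summand summand_subset_span_splittings by blast
  qed
qed

lemma lookup_contracted_form_basis_sum:
  fixes F :: "4 \<Rightarrow> 3 \<Rightarrow> 3"
  assumes "distinct [i, j, k, l]"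
  shows "Poly_Mapping.lookup (contracted_form (basis_sum F) i j k l) m =
    (if m = bimonomial (range_mset (F k)) (range_mset (F l)) then index_sign (F i) * index_sign (F j)
     else (0 :: 'a::comm_ring_1))"
proof -
  have "mconst (basis_sum F I :: 'a) = (basis_sum F I :: (3 + 3, 'a) mpoly)" for I
    by (auto simp: basis_sum_def mconst.hom_sum mconst.hom_one mconst.hom_zero intro!: sum.cong)
  moreover have "(index_sign f :: (3 + 3, 'a) mpoly) = mconst (index_sign f)" for f :: "3 \<Rightarrow> 3"
    by (simp add: index_sign_def det_of_rows_def mconst.hom_det axis_def if_distrib[of mconst]
        mconst.hom_one mconst.hom_zero cong: if_cong)
  ultimately have "contracted_form (basis_sum F) i j k l =
      mconst (index_sign (F i) * index_sign (F j) :: 'a) *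
      Poly_Mapping.single (bimonomial (range_mset (F k)) (range_mset (F l))) 1"
    by (simp add: contracted_form_def det_contracted_matrix_basis_sum[OF assms]
        prod_mvar_eq_single_bimonomial mconst.hom_mult)
  then show ?thesis
    by (simp add: lookup_mconst_mult lookup_single when_def)
qed

definition diagonal_tensor :: "4 \<Rightarrow> 4 \<Rightarrow> (3 \<Rightarrow> 3) \<Rightarrow> (3 \<Rightarrow> 3) \<Rightarrow> tensor" where
  "diagonal_tensor k l u v = basis_sum ((\<lambda>_. id)(k := u, l := v))"

definition dual_functional :: "4 \<Rightarrow> 4 \<Rightarrow> (3 \<Rightarrow> 3) \<Rightarrow> (3 \<Rightarrow> 3) \<Rightarrow> tensor_poly \<Rightarrow> complex" where
  "dual_functional k l u v f =
    (let \<tau> = Transposition.transpose 1 2; T = diagonal_tensor k l in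
      meval f (T u v) + meval f (T (u \<circ> \<tau>) v) + meval f (T u (v \<circ> \<tau>)) + meval f (T (u \<circ> \<tau>) (v \<circ> \<tau>)))"

lemma module_hom_dual_functional: "module_hom (\<lambda>c f. mconst c * f) (*) (dual_functional k l u v)"
  by unfold_locales
    (simp_all add: dual_functional_def Let_def meval.hom_add meval.hom_mult meval_mconst algebra_simps)

lemma dual_functional_coeff_self:
  assumes "distinct [i, j, k, l]"
  shows "dual_functional k l u v (Poly_Mapping.lookup (det_form i j k l) m) =
    (if m = bimonomial (range_mset u) (range_mset v) then 4 else 0)"
proof -
  have "(Transposition.transpose 1 2 :: 3 \<Rightarrow> 3) permutes UNIV"
    by (simp add: permutes_swap_id)
  then show ?thesis
    using assms
    by (simp add: dual_functional_def diagonal_tensor_def meval_coeff_det_form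
        lookup_contracted_form_basis_sum index_sign_id range_mset_permute)
qed

lemma meval_coeff_det_form_basis_sum_permute:
  fixes F :: "4 \<Rightarrow> 3 \<Rightarrow> 3"
  assumes distinct: "distinct [i, j, k, l]" and "c \<in> {i, j}" and \<tau>: "\<tau> permutes UNIV"
  shows "meval (Poly_Mapping.lookup (det_form i j k l) m) (basis_sum (F(c := F c \<circ> \<tau>)))
    = of_int (sign \<tau>) * meval (Poly_Mapping.lookup (det_form i j k l) m) (basis_sum F)"
  using assms
  by (auto simp: meval_coeff_det_form lookup_contracted_form_basis_sum[OF distinct] index_sign_permute[OF \<tau>])

lemma dual_functional_coeff_other:
  assumes distinct: "distinct [i, j, k, l]" and "k' \<noteq> l'" and "k' \<in> {i, j} \<or> l' \<in> {i, j}"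
  shows "dual_functional k' l' u v (Poly_Mapping.lookup (det_form i j k l) m) = 0"
proof -
  let ?\<tau> = "Transposition.transpose 1 2 :: 3 \<Rightarrow> 3"
  let ?e = "\<lambda>u v. meval (Poly_Mapping.lookup (det_form i j k l) m) (diagonal_tensor k' l' u v)"
  have \<tau>: "?\<tau> permutes UNIV" "sign ?\<tau> = - 1"
    by (simp_all add: permutes_swap_id sign_swap_id)
  note antisym = meval_coeff_det_form_basis_sum_permute[OF distinct _ \<tau>(1), unfolded \<tau>(2)]
  from assms(3) show ?thesis
  proof
    assume "k' \<in> {i, j}"
    from antisym[OF this, of m "(\<lambda>_. id)(k' := _, l' := _)"] have "?e (u \<circ> ?\<tau>) v = - ?e u v" for u v
      using \<open>k' \<noteq> l'\<close> by (simp add: diagonal_tensor_def fun_upd_twist)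
    then show ?thesis
      by (simp add: dual_functional_def Let_def)
  next
    assume "l' \<in> {i, j}"
    from antisym[OF this, of m "(\<lambda>_. id)(k' := _, l' := _)"] have "?e u (v \<circ> ?\<tau>) = - ?e u v" for u v
      by (simp add: diagonal_tensor_def)
    then show ?thesis
      by (simp add: dual_functional_def Let_def)
  qed
qed

lemma splittings_neq:
  assumes "(i, j, k, l) \<in> splittings" and "(i', j', k', l') \<in> splittings"
    and "(i, j, k, l) \<noteq> (i', j', k', l')"
  shows "k' \<in> {i, j} \<or> l' \<in> {i, j}"
  using assms by (auto simp: splittings_def)

lemma dual_functional_coeff_of_splitting:
  assumes "b \<in> splittings \<times> bicubic_monomials"
  shows "\<exists>\<phi>. module_hom (\<lambda>c f. mconst c * f) (*) \<phi> \<and> \<phi> (coeff_of_splitting b) \<noteq> 0 \<and>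
    (\<forall>b'\<in>splittings \<times> bicubic_monomials - {b}. \<phi> (coeff_of_splitting b') = 0)"
proof -
  obtain i j k l and u v :: "3 \<Rightarrow> 3" where P: "(i, j, k, l) \<in> splittings"
    and b: "b = ((i, j, k, l), bimonomial (range_mset u) (range_mset v))"
    using assms by (auto simp: in_bicubic_monomials_iff)
  note distinct = distinct_if_splitting[OF P]
  have "dual_functional k l u v (coeff_of_splitting b) \<noteq> 0"
    by (simp add: b coeff_of_splitting_def dual_functional_coeff_self[OF distinct])
  moreover have "dual_functional k l u v (coeff_of_splitting b') = 0"
    if "b' \<in> splittings \<times> bicubic_monomials - {b}" for b'
  proof -
    obtain i' j' k' l' m where b': "b' = ((i', j', k', l'), m)"
      by (metis surj_pair)
    then have P': "(i', j', k', l') \<in> splittings"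
      using that by simp
    show ?thesis
    proof (cases "(i', j', k', l') = (i, j, k, l)")
      case True
      then show ?thesis
        using that by (simp add: b b' coeff_of_splitting_def dual_functional_coeff_self[OF distinct])
    next
      case False
      then show ?thesis
        using splittings_neq[OF P' P] distinct distinct_if_splitting[OF P']
        by (simp add: b' coeff_of_splitting_def dual_functional_coeff_other)
    qed
  qed
  ultimately show ?thesis
    using module_hom_dual_functional by blast
qed

lemma dim_S3_S3_S111_S111: "tpoly.dim S3_S3_S111_S111 = 600"
proof -
  let ?S = "splittings \<times> bicubic_monomials"
  have finite: "finite ?S"
    by (simp add: splittings_def finite_bicubic_monomials)
  note independent = tpoly.independent_image_if_dual[OF finite dual_functional_coeff_of_splitting]
  have "card splittings = 6"
    by (simp add: splittings_def)
  then have "card (coeff_of_splitting ` ?S) = 600"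
    by (simp add: card_image[OF independent(1)] card_cartesian_product card_bicubic_monomials)
  then show ?thesis
    using tpoly.dim_span_eq_card_independent[OF independent(2)] by (simp add: span_coeff_of_splitting)
qed

theorem proposition5p3:
  fixes Q :: tensor and B :: "tensor_poly set"
  assumes "quadrifocal Q"
    and "tpoly.independent B" and "tpoly.span B = S3_S3_S111_S111"
  shows "G_submodule S3_S3_S111_S111 \<and> S3_S3_S111_S111 \<subseteq> cubic_forms
    \<and> card B = 600 \<and> (\<forall>f\<in>B. meval f Q = 0)"
proof (intro conjI ballI)
  show "G_submodule S3_S3_S111_S111"
    by (rule G_submodule_S3_S3_S111_S111)
  show "S3_S3_S111_S111 \<subseteq> cubic_forms"
    by (rule S3_S3_S111_S111_cubic)
  show "card B = 600"
    using tpoly.dim_span_eq_card_independent[OF assms(2)] by (simp add: assms(3) dim_S3_S3_S111_S111)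
  fix f assume "f \<in> B"
  then have "f \<in> S3_S3_S111_S111"
    using tpoly.span_base assms(3) by blast
  then show "meval f Q = 0"
    by (rule S3_S3_S111_S111_vanish_quadrifocal[OF assms(1)])
qed

end
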